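(* Let $F^*\in\mathbb R^{T\times r}$ and $B^*\in\mathbb R^{N\times r}$ be such that (i) the smallest eigenvalues of $B^{*\prime}B^*$ and of $T^{-1}F^{*\prime}F^*$ are bounded away from zero, and (ii) the $r$ eigenvalues of $B^{*\prime}B^*(T^{-1}F^{*\prime}F^* )$ are distinct. Then there exists an invertible matrix $H\in\mathbb R^{r\times r}$ such that $F^0:=F^*H$ and $B^0:=B^*H^{\prime-1}$ (so that $F^0B^{0\prime}=F^*B^{*\prime}$) satisfy $$\frac1T F^{0\prime}F^0=I_r\quad\text{and}\quad B^{0\prime}B^0\in\mathcal D(r).$$ This $H$ is unique up to column sign changes (any other such matrix equals $HS$ for a diagonal matrix $S$ with diagonal entries $\pm1$), and it is explicitly given by $H=PV^{-1/2}$. In particular, $B^{0\prime}B^0=\Lambda$.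
   Context: A prime denotes transpose, and $H^{\prime-1}=(H')^{-1}$. $N,T,r$ are positive integers. $\mathcal D(r)$ is the set of all $r\times r$ diagonal matrices with positive diagonal entries in non-increasing order. $\Lambda$ is the $r\times r$ diagonal matrix containing the eigenvalues of $B^{*\prime}B^*(T^{-1}F^{*\prime}F^* )$ in descending order, and $P$ is the $r\times r$ matrix whose columns are the corresponding normalized (unit Euclidean norm) eigenvectors, so that $B^{*\prime}B^*(T^{-1}F^{*\prime}F^* )P=P\Lambda$. Furthermore $V=P'(T^{-1}F^{*\prime}F^* )P$. ("Bounded away from zero" means bounded below by a positive constant not depending on $N,T$; for fixed $N,T$ it amounts to positive definiteness.) *)

theory Defs
  imports
    Complex_Main
    "Jordan_Normal_Form.Gauss_Jordan_Elimination"
    "Jordan_Normal_Form.Spectral_Radius"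
begin

text \<open>Only meaningful for invertible arguments.\<close>

definition inv_mat :: "real mat \<Rightarrow> real mat" where
  "inv_mat A = the (mat_inverse A)"

definition psd_mat :: "real mat \<Rightarrow> bool" where
  "psd_mat A \<longleftrightarrow> square_mat A \<and> A\<^sup>T = A \<and>
     (\<forall>x \<in> carrier_vec (dim_row A). 0 \<le> x \<bullet> (A *\<^sub>v x))"

text \<open>The principal square root; only meaningful for symmetric positive semidefinite arguments.\<close>

definition sqrt_mat :: "real mat \<Rightarrow> real mat" where
  "sqrt_mat A = (THE R. R \<in> carrier_mat (dim_row A) (dim_row A) \<and> psd_mat R \<and> R * R = A)"

definition inv_sqrt_mat :: "real mat \<Rightarrow> real mat" where
  "inv_sqrt_mat A = inv_mat (sqrt_mat A)"

definition desc_pos_diag :: "nat \<Rightarrow> real mat set" where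
  "desc_pos_diag r = {D \<in> carrier_mat r r. diagonal_mat D \<and>
     (\<forall>i<r. 0 < D $$ (i,i)) \<and> (\<forall>i j. i \<le> j \<and> j < r \<longrightarrow> D $$ (j,j) \<le> D $$ (i,i))}"

definition sign_diag :: "nat \<Rightarrow> real mat set" where
  "sign_diag r = {S \<in> carrier_mat r r. diagonal_mat S \<and>
     (\<forall>i<r. S $$ (i,i) = 1 \<or> S $$ (i,i) = -1)}"

definition scaled_gram :: "nat \<Rightarrow> real mat \<Rightarrow> real mat" where
  "scaled_gram T F = (1 / real T) \<cdot>\<^sub>m (F\<^sup>T * F)"

text \<open>
  The factorisation of the characteristic polynomial says that the diagonal of \<open>L\<close> lists the
  eigenvalues of \<open>A\<close> with algebraic multiplicity.
\<close>

definition ordered_eigendecomp :: "nat \<Rightarrow> real mat \<Rightarrow> real mat \<Rightarrow> real mat \<Rightarrow> bool" where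
  "ordered_eigendecomp r A L P \<longleftrightarrow>
     L \<in> carrier_mat r r \<and> diagonal_mat L \<and>
     char_poly A = (\<Prod>a \<leftarrow> diag_mat L. [:- a, 1:]) \<and> sorted_wrt (\<ge>) (diag_mat L) \<and>
     P \<in> carrier_mat r r \<and> A * P = P * L \<and>
     (\<forall>j<r. sqrt (col P j \<bullet> col P j) = 1)"

definition rot_factors :: "real mat \<Rightarrow> real mat \<Rightarrow> real mat" where
  "rot_factors Fs H = Fs * H"

definition rot_loadings :: "real mat \<Rightarrow> real mat \<Rightarrow> real mat" where
  "rot_loadings Bs H = Bs * inv_mat (H\<^sup>T)"

definition normalizing_rotation ::
    "nat \<Rightarrow> nat \<Rightarrow> real mat \<Rightarrow> real mat \<Rightarrow> real mat \<Rightarrow> bool" where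
  "normalizing_rotation T r Fs Bs H \<longleftrightarrow>
     H \<in> carrier_mat r r \<and> invertible_mat H \<and>
     scaled_gram T (rot_factors Fs H) = 1\<^sub>m r \<and>
     (rot_loadings Bs H)\<^sup>T * rot_loadings Bs H \<in> desc_pos_diag r"

end

theory Submission
  imports Defs
begin

text \<open>
  Write \<open>A = Bs' Bs\<close> and \<open>G = Fs' Fs / T\<close>; both are positive definite. The normalisation of the
  factors reads \<open>H' G H = I\<close>, which forces \<open>H'\<^sup>-\<^sup>1 = G H\<close>, so that the Gram matrix of the loadings
  is \<open>D = H' G A G H\<close>, that is, \<open>A G H = H D\<close>. Hence \<open>H\<close> normalises exactly if its columns are
  \<open>G\<close>-orthonormal eigenvectors of \<open>A G\<close> in descending order of the eigenvalues. As \<open>A G\<close> is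
  self-adjoint for the inner product of \<open>G\<close>, its eigenvalues are real, and eigenvectors to distinct
  eigenvalues are \<open>G\<close>-orthogonal: \<open>V = P' G P\<close> is diagonal, and \<open>P V\<^sup>-\<^sup>1\<^sup>/\<^sup>2\<close> normalises. Two
  solutions differ by a matrix that commutes with the distinct-entry \<open>\<Lambda>\<close> and squares to the identity.
\<close>

definition pos_def_mat :: "nat \<Rightarrow> real mat \<Rightarrow> bool" where
  "pos_def_mat r G \<longleftrightarrow> G \<in> carrier_mat r r \<and> G\<^sup>T = G \<and>
     (\<forall>x \<in> carrier_vec r. x \<noteq> 0\<^sub>v r \<longrightarrow> 0 < x \<bullet> (G *\<^sub>v x))"

lemma scalar_prod_self_real:
  fixes v :: "real vec"
  assumes "v \<in> carrier_vec n"
  shows "0 \<le> v \<bullet> v" and "v \<bullet> v = 0 \<longleftrightarrow> v = 0\<^sub>v n"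
proof -
  show "0 \<le> v \<bullet> v" by (simp add: scalar_prod_def sum_nonneg)
  have "v \<bullet> v = 0 \<longleftrightarrow> (\<forall>i<n. v $ i = 0)"
    using assms by (auto simp: scalar_prod_def sum_nonneg_eq_0_iff)
  also have "\<dots> \<longleftrightarrow> v = 0\<^sub>v n" using assms by auto
  finally show "v \<bullet> v = 0 \<longleftrightarrow> v = 0\<^sub>v n" .
qed

lemma pos_def_mat_gram:
  fixes F :: "real mat"
  assumes F: "F \<in> carrier_mat m r" and k: "0 < k" and c: "0 < c"
    and min: "c \<le> Min (spectrum (k \<cdot>\<^sub>m (F\<^sup>T * F)))"
  shows "pos_def_mat r (k \<cdot>\<^sub>m (F\<^sup>T * F))"
proof -
  define G where "G = k \<cdot>\<^sub>m (F\<^sup>T * F)"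
  have Gc: "G \<in> carrier_mat r r" using F by (simp add: G_def)
  have sym: "G\<^sup>T = G"
    using F by (intro eq_matI) (auto simp: G_def intro!: comm_scalar_prod[of _ m])
  have Gx: "G *\<^sub>v x = k \<cdot>\<^sub>v (F\<^sup>T *\<^sub>v (F *\<^sub>v x))" if x: "x \<in> carrier_vec r" for x
  proof -
    have "G *\<^sub>v x = k \<cdot>\<^sub>v ((F\<^sup>T * F) *\<^sub>v x)"
      using F x by (intro eq_vecI) (auto simp: G_def simp del: assoc_mult_mat_vec)
    then show ?thesis using F x assoc_mult_mat_vec[of "F\<^sup>T" r m F r x] by simp
  qed
  have "0 < x \<bullet> (G *\<^sub>v x)" if x: "x \<in> carrier_vec r" and x0: "x \<noteq> 0\<^sub>v r" for x
  proof -
    have Fx: "F *\<^sub>v x \<in> carrier_vec m" using F x by simp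
    have "x \<bullet> (F\<^sup>T *\<^sub>v (F *\<^sub>v x)) = (F *\<^sub>v x) \<bullet> (F *\<^sub>v x)"
      using transpose_vec_mult_scalar[OF F x Fx] comm_scalar_prod[OF x, of "F\<^sup>T *\<^sub>v (F *\<^sub>v x)"] F x
      by simp
    then have eq: "x \<bullet> (G *\<^sub>v x) = k * ((F *\<^sub>v x) \<bullet> (F *\<^sub>v x))"
      using x F by (simp add: Gx)
    have "F *\<^sub>v x \<noteq> 0\<^sub>v m"
    proof
      assume "F *\<^sub>v x = 0\<^sub>v m"
      then have "G *\<^sub>v x = 0 \<cdot>\<^sub>v x"
        using F x by (auto simp: Gx intro!: eq_vecI)
      then have "0 \<in> spectrum G"
        using Gc x x0 by (auto simp: spectrum_def eigenvalue_def eigenvector_def)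
      then have "Min (spectrum G) \<le> 0" using card_finite_spectrum(1)[OF Gc] by simp
      then show False using min c by (simp add: G_def)
    qed
    then have "0 < (F *\<^sub>v x) \<bullet> (F *\<^sub>v x)"
      using scalar_prod_self_real[OF Fx] by linarith
    then show ?thesis using k eq by simp
  qed
  then show ?thesis using Gc sym by (simp add: pos_def_mat_def G_def[symmetric])
qed

lemma inv_mat_eqI:
  assumes X: "X \<in> carrier_mat n n" and Y: "Y \<in> carrier_mat n n" and XY: "X * Y = 1\<^sub>m n"
  shows "inv_mat X = Y"
proof -
  have YX: "Y * X = 1\<^sub>m n" by (rule mat_mult_left_right_inverse[OF X Y XY])
  have "X \<in> Units (ring_mat TYPE(real) n ())"
    using X Y XY YX by (auto simp: Units_def ring_mat_simps)
  then obtain Z where Z: "mat_inverse X = Some Z"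
    using mat_inverse(1)[OF X, where b = "()"] by (cases "mat_inverse X") auto
  from mat_inverse(2)[OF X Z] have ZX: "Z * X = 1\<^sub>m n" and Zc: "Z \<in> carrier_mat n n" by auto
  have "Z = Z * (X * Y)" using XY Zc by simp
  also have "\<dots> = Z * X * Y" using assoc_mult_mat[OF Zc X Y] by simp
  also have "\<dots> = Y" using ZX Y by simp
  finally show ?thesis by (simp add: inv_mat_def Z)
qed

lemma invertible_matI:
  fixes X :: "real mat"
  assumes "X \<in> carrier_mat n n" "Y \<in> carrier_mat n n" "X * Y = 1\<^sub>m n"
  shows "invertible_mat X"
  using assms mat_mult_left_right_inverse[OF assms]
  unfolding invertible_mat_def inverts_mat_def by auto

lemma diagonal_mat_eq_mat_diag:
  "D \<in> carrier_mat n n \<Longrightarrow> diagonal_mat D \<Longrightarrow> D = mat_diag n (\<lambda>i. D $$ (i,i))"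
  by (auto simp: mat_diag_def diagonal_mat_def)

lemma diagonal_mat_mat_diag [simp]: "diagonal_mat (mat_diag n f)"
  by (auto simp: mat_diag_def diagonal_mat_def)

lemma mat_diag_index [simp]: "i < n \<Longrightarrow> j < n \<Longrightarrow> mat_diag n f $$ (i,j) = (if i = j then f j else 0)"
  by (simp add: mat_diag_def)

lemma mat_diag_dims [simp]: "dim_row (mat_diag n f) = n" "dim_col (mat_diag n f) = n"
  by (simp_all add: mat_diag_def)

lemma mat_diag_mult_vec:
  fixes f :: "nat \<Rightarrow> 'a :: semiring_0"
  assumes "x \<in> carrier_vec n"
  shows "mat_diag n f *\<^sub>v x = vec n (\<lambda>i. f i * x $ i)"
  using assms
  by (intro eq_vecI)
     (auto simp: mat_diag_def scalar_prod_def if_distrib[of "\<lambda>a. a * _"] cong: if_cong)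

lemma diag_mat_mat_diag [simp]: "diag_mat (mat_diag n f) = map f [0..<n]"
  by (auto simp: diag_mat_def mat_diag_def)

lemma char_poly_mat_diag:
  fixes f :: "nat \<Rightarrow> 'a :: comm_ring_1"
  shows "char_poly (mat_diag n f) = (\<Prod>a \<leftarrow> map f [0..<n]. [:- a, 1:])"
proof -
  have "upper_triangular (mat_diag n f)" by (auto simp: upper_triangular_def)
  then show ?thesis using char_poly_upper_triangular[of "mat_diag n f" n] by simp
qed

lemma commute_mat_diag_entry:
  fixes S :: "'a :: idom mat"
  assumes S: "S \<in> carrier_mat n n" and comm: "mat_diag n f * S = S * mat_diag n f"
    and ij: "i < n" "j < n" and "f i \<noteq> f j"
  shows "S $$ (i,j) = 0"
proof -
  have "f i * S $$ (i,j) = S $$ (i,j) * f j"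
    using arg_cong[OF comm, of "\<lambda>X. X $$ (i,j)"] ij
    by (simp add: mat_diag_mult_left[OF S] mat_diag_mult_right[OF S])
  then have "(f i - f j) * S $$ (i,j) = 0" by (simp add: algebra_simps)
  then show ?thesis using assms by simp
qed

lemma commute_mat_diag_inj:
  fixes S :: "'a :: idom mat"
  assumes S: "S \<in> carrier_mat n n" and "mat_diag n f * S = S * mat_diag n f"
    and "inj_on f {..<n}"
  shows "diagonal_mat S"
  using commute_mat_diag_entry[OF assms(1,2)] assms(3) S
  by (auto simp: diagonal_mat_def inj_on_def)

lemma psd_mat_mat_diag:
  assumes "\<And>i. i < n \<Longrightarrow> 0 \<le> f i"
  shows "psd_mat (mat_diag n f)"
proof -
  have "(mat_diag n f)\<^sup>T = mat_diag n f" by (auto simp: mat_diag_def)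
  moreover have "0 \<le> x \<bullet> (mat_diag n f *\<^sub>v x)" if "x \<in> carrier_vec n" for x
    using assms that
    by (auto simp: mat_diag_mult_vec scalar_prod_def intro!: sum_nonneg)
       (metis mult.left_commute mult_nonneg_nonneg zero_le_square)
  ultimately show ?thesis by (simp add: psd_mat_def mat_diag_def)
qed

text \<open>
  A positive semidefinite root \<open>R\<close> commutes with \<open>mat_diag n v\<close>, hence with its diagonal root \<open>D\<close>;
  so \<open>(R + D) (R - D) = 0\<close>, where \<open>R + D\<close> is positive definite.
\<close>

lemma sqrt_mat_mat_diag:
  assumes v: "\<And>i. i < n \<Longrightarrow> 0 < v i"
  shows "sqrt_mat (mat_diag n v) = mat_diag n (\<lambda>i. sqrt (v i))"
proof -
  define D where "D = mat_diag n (\<lambda>i. sqrt (v i))"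
  have Dc: "D \<in> carrier_mat n n" by (simp add: D_def)
  have DD: "D * D = mat_diag n v"
    unfolding D_def mat_diag_diag using v by (intro eq_matI) (auto simp: less_imp_le)
  have psd: "psd_mat D" unfolding D_def by (rule psd_mat_mat_diag) (use v less_imp_le in auto)
  have "R = D" if Rc: "R \<in> carrier_mat n n" and R: "psd_mat R" and RR: "R * R = mat_diag n v" for R
  proof -
    have "mat_diag n v * R = R * mat_diag n v"
      using assoc_mult_mat[OF Rc Rc Rc] by (simp add: RR[symmetric])
    note ent = commute_mat_diag_entry[OF Rc this]
    have comm: "D * R = R * D"
      unfolding D_def mat_diag_mult_left[OF Rc] mat_diag_mult_right[OF Rc]
    proof (intro eq_matI, goal_cases)
      case (1 i j)
      then show ?case using ent[of i j] by (cases "v i = v j") auto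
    qed auto
    have RDc: "R + D \<in> carrier_mat n n" "R - D \<in> carrier_mat n n" using Rc Dc by auto
    have prod: "(R + D) * (R - D) = 0\<^sub>m n n"
    proof -
      have "(R + D) * (R - D) = R * (R - D) + D * (R - D)"
        using Rc Dc RDc by (intro add_mult_distrib_mat) auto
      also have "\<dots> = (R * R - R * D) + (D * R - D * D)"
        using mult_minus_distrib_mat[OF Rc Rc Dc] mult_minus_distrib_mat[OF Dc Rc Dc] by simp
      also have "\<dots> = 0\<^sub>m n n"
        unfolding comm RR DD using Rc Dc by (intro eq_matI) auto
      finally show ?thesis .
    qed
    have "det (R + D) \<noteq> 0"
    proof
      assume "det (R + D) = 0"
      then obtain x where x: "x \<in> carrier_vec n" "x \<noteq> 0\<^sub>v n" "(R + D) *\<^sub>v x = 0\<^sub>v n"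
        using det_0_iff_vec_prod_zero_field[OF RDc(1)] by auto
      have "0 = x \<bullet> ((R + D) *\<^sub>v x)" using x by simp
      also have "\<dots> = x \<bullet> (R *\<^sub>v x) + x \<bullet> (D *\<^sub>v x)"
        using x(1) Rc Dc
        by (simp add: add_mult_distrib_mat_vec[OF Rc Dc] scalar_prod_add_distrib[of _ n])
      finally have "x \<bullet> (D *\<^sub>v x) \<le> 0"
        using R x(1) Rc by (auto simp: psd_mat_def)
      moreover have "x \<bullet> (D *\<^sub>v x) = (\<Sum>i<n. sqrt (v i) * (x $ i)\<^sup>2)"
        using x(1) unfolding D_def mat_diag_mult_vec[OF x(1)]
        by (auto simp: scalar_prod_def power2_eq_square lessThan_atLeast0 intro!: sum.cong)
      ultimately have "(\<Sum>i<n. sqrt (v i) * (x $ i)\<^sup>2) \<le> 0" by simp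
      moreover have nn: "0 \<le> sqrt (v i) * (x $ i)\<^sup>2" if "i < n" for i
        using v[OF that] by simp
      ultimately have "(\<Sum>i<n. sqrt (v i) * (x $ i)\<^sup>2) = 0"
        by (intro antisym sum_nonneg) auto
      then have "\<forall>i<n. sqrt (v i) * (x $ i)\<^sup>2 = 0"
        using nn by (subst (asm) sum_nonneg_eq_0_iff) auto
      then have "x = 0\<^sub>v n" using v x(1) by (intro eq_vecI) fastforce+
      then show False using x by simp
    qed
    then obtain Y where Y: "Y \<in> carrier_mat n n" "Y * (R + D) = 1\<^sub>m n"
      using det_non_zero_imp_unit[OF RDc(1)] by (auto simp: Units_def ring_mat_simps)
    have "R - D = Y * (R + D) * (R - D)"
      using Y(2) left_mult_one_mat[OF RDc(2)] by simp
    also have "\<dots> = Y * ((R + D) * (R - D))" by (rule assoc_mult_mat[OF Y(1) RDc])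
    also have "\<dots> = 0\<^sub>m n n" using Y by (simp add: prod)
    finally have z: "R - D = 0\<^sub>m n n" .
    show "R = D"
    proof (intro eq_matI)
      fix i j assume "i < dim_row D" "j < dim_col D"
      then show "R $$ (i,j) = D $$ (i,j)"
        using arg_cong[OF z, of "\<lambda>X. X $$ (i,j)"] Rc Dc by simp
    qed (use Rc Dc in auto)
  qed
  then have "sqrt_mat (mat_diag n v) = D"
    unfolding sqrt_mat_def mat_diag_dims using Dc psd DD by (intro the_equality) blast+
  then show ?thesis by (simp add: D_def)
qed


lemma pos_def_mat_sym:
  assumes "pos_def_mat r G" "x \<in> carrier_vec r" "y \<in> carrier_vec r"
  shows "x \<bullet> (G *\<^sub>v y) = y \<bullet> (G *\<^sub>v x)"
  using assms transpose_vec_mult_scalar[of G r r y x] comm_scalar_prod[of "G *\<^sub>v x" r y]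
    mult_mat_vec_carrier[of G r r x]
  by (simp add: pos_def_mat_def)

lemma poly_linear_factors_eq_0_iff:
  fixes k :: "'a :: idom"
  shows "poly (\<Prod>a \<leftarrow> xs. [:- a, 1:]) k = 0 \<longleftrightarrow> k \<in> set xs"
  by (induction xs) auto

lemma descending_roots_unique:
  fixes M :: "'a :: {field, linorder} mat"
  assumes M: "M \<in> carrier_mat r r" and card: "card (spectrum M) = r"
    and cp: "char_poly M = (\<Prod>a \<leftarrow> xs. [:- a, 1:])" and len: "length xs = r"
    and sorted: "sorted_wrt (\<ge>) xs"
  shows "distinct xs" and "xs = rev (sorted_list_of_set (spectrum M))"
proof -
  have set: "spectrum M = set xs"
    by (simp add: spectrum_root_char_poly[OF M] cp poly_linear_factors_eq_0_iff)
  show d: "distinct xs" using card len by (simp add: set card_distinct)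
  have "sorted (rev xs)" using sorted by (simp add: sorted_wrt_rev)
  then have "rev xs = sorted_list_of_set (spectrum M)"
    using d by (intro sorted_distinct_set_unique) (auto simp: set)
  then show "xs = rev (sorted_list_of_set (spectrum M))" by (metis rev_rev_ident)
qed

lemma char_poly_diagonalized:
  fixes M :: "'a :: field mat"
  assumes M: "M \<in> carrier_mat r r" and P: "P \<in> carrier_mat r r" and Q: "Q \<in> carrier_mat r r"
    and QP: "Q * P = 1\<^sub>m r" and MP: "M * P = P * mat_diag r l"
  shows "char_poly M = (\<Prod>a \<leftarrow> map l [0..<r]. [:- a, 1:])"
proof -
  have PQ: "P * Q = 1\<^sub>m r" by (rule mat_mult_left_right_inverse[OF Q P QP])
  have "M = M * (P * Q)" using M by (simp add: PQ)
  also have "\<dots> = P * mat_diag r l * Q" using assoc_mult_mat[OF M P Q] MP by simp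
  finally have "similar_mat M (mat_diag r l)"
    using M P Q PQ QP by (intro similar_matI[of _ _ P Q r]) auto
  then show ?thesis using char_poly_similar char_poly_mat_diag by metis
qed

locale pos_def_pair =
  fixes r :: nat and A G :: "real mat"
  assumes A: "pos_def_mat r A" and G: "pos_def_mat r G"
begin

lemma carriers [simp]: "A \<in> carrier_mat r r" "G \<in> carrier_mat r r"
  using A G by (auto simp: pos_def_mat_def)

lemma transposes [simp]: "A\<^sup>T = A" "G\<^sup>T = G"
  using A G by (auto simp: pos_def_mat_def)

lemma dims [simp]: "dim_row A = r" "dim_col A = r" "dim_row G = r" "dim_col G = r"
  using carrier_matD[OF carriers(1)] carrier_matD[OF carriers(2)] by simp_all

lemma mult_vec_carrier [simp]:
  "x \<in> carrier_vec r \<Longrightarrow> A *\<^sub>v x \<in> carrier_vec r" "x \<in> carrier_vec r \<Longrightarrow> G *\<^sub>v x \<in> carrier_vec r"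
  by (rule mult_mat_vec_carrier; simp)+

lemma product_carrier [simp]: "A * G \<in> carrier_mat r r"
  by (rule mult_carrier_mat[OF carriers])

lemma eigenvalue_pos:
  assumes v: "v \<in> carrier_vec r" "v \<noteq> 0\<^sub>v r" and ev: "A * G *\<^sub>v v = l \<cdot>\<^sub>v v"
  shows "0 < l"
proof -
  define w where "w = G *\<^sub>v v"
  have w: "w \<in> carrier_vec r" using v by (simp add: w_def)
  have vw: "0 < v \<bullet> w" using G v by (simp add: pos_def_mat_def w_def)
  then have "w \<noteq> 0\<^sub>v r" using v by auto
  then have "0 < w \<bullet> (A *\<^sub>v w)" using A w by (simp add: pos_def_mat_def)
  also have "A *\<^sub>v w = l \<cdot>\<^sub>v v"
    using ev v assoc_mult_mat_vec[OF carriers v(1)] by (simp add: w_def)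
  also have "w \<bullet> (l \<cdot>\<^sub>v v) = l * (v \<bullet> w)"
    using v w comm_scalar_prod[OF v(1) w] by simp
  finally show ?thesis using vw by (simp add: zero_less_mult_iff)
qed

text \<open>
  Split an eigenvector into real and imaginary parts \<open>a\<close>, \<open>b\<close>. Since \<open>G A G\<close> is symmetric,
  comparing \<open>a' G A G b\<close> with \<open>b' G A G a\<close> gives \<open>Im z (a' G a + b' G b) = 0\<close>.
\<close>

lemma complex_eigenvalue_real:
  assumes "eigenvalue (map_mat complex_of_real (A * G)) z"
  shows "Im z = 0"
proof -
  obtain v where v: "v \<in> carrier_vec r" "v \<noteq> 0\<^sub>v r"
    and ev: "map_mat complex_of_real (A * G) *\<^sub>v v = z \<cdot>\<^sub>v v"
    using assms by (auto simp: eigenvalue_def eigenvector_def)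
  define a where "a = map_vec Re v"
  define b where "b = map_vec Im v"
  have a: "a \<in> carrier_vec r" and b: "b \<in> carrier_vec r" using v by (auto simp: a_def b_def)
  have ent: "(\<Sum>j\<in>{0..<r}. complex_of_real ((A * G) $$ (i,j)) * v $ j) = z * v $ i" if "i < r" for i
    using arg_cong[OF ev, of "\<lambda>x. x $ i"] v that by (simp add: scalar_prod_def)
  have re: "A * G *\<^sub>v a = Re z \<cdot>\<^sub>v a - Im z \<cdot>\<^sub>v b"
  proof (rule eq_vecI)
    fix i assume "i < dim_vec (Re z \<cdot>\<^sub>v a - Im z \<cdot>\<^sub>v b)"
    then have i: "i < r" using b by simp
    show "(A * G *\<^sub>v a) $ i = (Re z \<cdot>\<^sub>v a - Im z \<cdot>\<^sub>v b) $ i"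
      using arg_cong[OF ent[OF i], of Re] i v
      by (simp add: a_def b_def scalar_prod_def)
  qed (use b in auto)
  have im: "A * G *\<^sub>v b = Im z \<cdot>\<^sub>v a + Re z \<cdot>\<^sub>v b"
  proof (rule eq_vecI)
    fix i assume "i < dim_vec (Im z \<cdot>\<^sub>v a + Re z \<cdot>\<^sub>v b)"
    then have i: "i < r" using b by simp
    show "(A * G *\<^sub>v b) $ i = (Im z \<cdot>\<^sub>v a + Re z \<cdot>\<^sub>v b) $ i"
      using arg_cong[OF ent[OF i], of Im] i v
      by (simp add: a_def b_def scalar_prod_def)
  qed (use b in auto)
  define wa where "wa = G *\<^sub>v a"
  define wb where "wb = G *\<^sub>v b"
  have wa: "wa \<in> carrier_vec r" and wb: "wb \<in> carrier_vec r"
    using a b by (auto simp: wa_def wb_def)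
  have Awa: "A *\<^sub>v wa = Re z \<cdot>\<^sub>v a - Im z \<cdot>\<^sub>v b"
    using re assoc_mult_mat_vec[OF carriers a] by (simp add: wa_def)
  have Awb: "A *\<^sub>v wb = Im z \<cdot>\<^sub>v a + Re z \<cdot>\<^sub>v b"
    using im assoc_mult_mat_vec[OF carriers b] by (simp add: wb_def)
  have "wa \<bullet> (A *\<^sub>v wb) = wb \<bullet> (A *\<^sub>v wa)" by (rule pos_def_mat_sym[OF A wa wb])
  then have "Im z * (wa \<bullet> a) + Re z * (wa \<bullet> b) = Re z * (wb \<bullet> a) - Im z * (wb \<bullet> b)"
    using a b wa wb
    by (simp add: Awa Awb scalar_prod_add_distrib[of _ r] scalar_prod_minus_distrib[of _ r])
  moreover have "wa \<bullet> b = wb \<bullet> a"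
    using pos_def_mat_sym[OF G a b] comm_scalar_prod[OF wa b] comm_scalar_prod[OF wb a]
    by (simp add: wa_def wb_def)
  ultimately have eq: "Im z * (wa \<bullet> a + wb \<bullet> b) = 0" by (simp add: algebra_simps)
  have nonneg: "0 \<le> (G *\<^sub>v x) \<bullet> x" and pos: "x \<noteq> 0\<^sub>v r \<Longrightarrow> 0 < (G *\<^sub>v x) \<bullet> x"
    if x: "x \<in> carrier_vec r" for x
  proof -
    have c: "(G *\<^sub>v x) \<bullet> x = x \<bullet> (G *\<^sub>v x)" using x by (intro comm_scalar_prod[of _ r]) auto
    show pos: "0 < (G *\<^sub>v x) \<bullet> x" if "x \<noteq> 0\<^sub>v r"
      using G x that by (simp add: pos_def_mat_def c)
    show "0 \<le> (G *\<^sub>v x) \<bullet> x"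
      using pos x by (cases "x = 0\<^sub>v r") (auto simp: less_imp_le)
  qed
  have "a \<noteq> 0\<^sub>v r \<or> b \<noteq> 0\<^sub>v r"
  proof (rule ccontr)
    assume "\<not> ?thesis"
    then have "a $ i = 0" "b $ i = 0" if "i < r" for i using that by auto
    then have "v $ i = 0" if "i < r" for i
      using that v by (simp add: a_def b_def complex_eq_iff)
    then have "v = 0\<^sub>v r" using v by (intro eq_vecI) auto
    then show False using v by simp
  qed
  then have "0 < wa \<bullet> a + wb \<bullet> b"
    using nonneg[OF a] nonneg[OF b] pos[OF a] pos[OF b] by (auto simp: wa_def wb_def)
  then show ?thesis using eq by simp
qed

lemma complex_spectrum:
  "spectrum (map_mat complex_of_real (A * G)) = complex_of_real ` spectrum (A * G)"
proof -
  have M: "A * G \<in> carrier_mat r r"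
    and M': "map_mat complex_of_real (A * G) \<in> carrier_mat r r" by auto
  have iff: "complex_of_real x \<in> spectrum (map_mat complex_of_real (A * G)) \<longleftrightarrow> x \<in> spectrum (A * G)"
    for x
    by (simp add: spectrum_root_char_poly[OF M] spectrum_root_char_poly[OF M']
        of_real_hom.char_poly_hom[OF M])
  have "z \<in> complex_of_real ` spectrum (A * G)"
    if z: "z \<in> spectrum (map_mat complex_of_real (A * G))" for z
  proof -
    have "z = complex_of_real (Re z)"
      using z complex_eigenvalue_real by (simp add: spectrum_def complex_eq_iff)
    then show ?thesis using z iff by (metis image_eqI)
  qed
  then show ?thesis using iff by auto
qed

lemma card_real_spectrum:
  "card (spectrum (map_mat complex_of_real (A * G))) = card (spectrum (A * G))"
  unfolding complex_spectrum by (intro card_image inj_onI) simp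

lemma assoc: "X \<in> carrier_mat r r \<Longrightarrow> Y \<in> carrier_mat r r \<Longrightarrow> Z \<in> carrier_mat r r \<Longrightarrow>
    X * Y * Z = X * (Y * Z)" for X Y Z :: "real mat"
  by (rule assoc_mult_mat)

lemma closed [simp]: "X \<in> carrier_mat r r \<Longrightarrow> Y \<in> carrier_mat r r \<Longrightarrow> X * Y \<in> carrier_mat r r"
  for X Y :: "real mat"
  by (rule mult_carrier_mat)

lemma transpose_prod: "X \<in> carrier_mat r r \<Longrightarrow> Y \<in> carrier_mat r r \<Longrightarrow> (X * Y)\<^sup>T = Y\<^sup>T * X\<^sup>T"
  for X Y :: "real mat"
  by (rule transpose_mult)

lemma gram_eigenvectors:
  assumes P: "P \<in> carrier_mat r r" and MP: "A * G * P = P * mat_diag r l"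
    and inj: "inj_on l {..<r}" and nz: "\<And>j. j < r \<Longrightarrow> col P j \<noteq> 0\<^sub>v r"
  obtains v where "\<And>i. i < r \<Longrightarrow> 0 < v i" and "P\<^sup>T * G * P = mat_diag r v"
proof -
  define V where "V = P\<^sup>T * G * P"
  let ?D = "mat_diag r l"
  have Pt: "P\<^sup>T \<in> carrier_mat r r" using P by simp
  have V: "V \<in> carrier_mat r r" using P Pt by (simp add: V_def)
  have Vt: "V\<^sup>T = V" using P Pt by (simp add: V_def transpose_prod assoc)
  have Dt: "?D\<^sup>T = ?D" by (auto simp: mat_diag_def)
  have VD: "V * ?D = P\<^sup>T * (G * (A * (G * P)))"
    using P Pt MP by (simp add: V_def assoc)
  have "(V * ?D)\<^sup>T = V * ?D"
    using P Pt unfolding VD by (simp add: transpose_prod assoc)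
  then have comm: "?D * V = V * ?D" using V by (simp add: transpose_prod Vt Dt)
  have diag: "V = mat_diag r (\<lambda>i. V $$ (i,i))"
    by (rule diagonal_mat_eq_mat_diag[OF V commute_mat_diag_inj[OF V comm inj]])
  have "0 < V $$ (i,i)" if i: "i < r" for i
  proof -
    have "V $$ (i,i) = (P\<^sup>T * (G * P)) $$ (i,i)" using P Pt by (simp add: V_def assoc)
    also have "\<dots> = col P i \<bullet> (G *\<^sub>v col P i)"
      using P i col_mult2[OF carriers(2) P i] by simp
    also have "\<dots> > 0" using G P i nz by (auto simp: pos_def_mat_def)
    finally show ?thesis .
  qed
  then show ?thesis using that[OF _ diag[unfolded V_def]] by (simp add: V_def)
qed

lemma gram_inverse:
  assumes P: "P \<in> carrier_mat r r" and v: "\<And>i. i < r \<Longrightarrow> 0 < v i"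
    and V: "P\<^sup>T * G * P = mat_diag r v"
  obtains Q where "Q \<in> carrier_mat r r" "Q * P = 1\<^sub>m r"
proof
  let ?E = "mat_diag r (\<lambda>i. 1 / v i)"
  show "?E * (P\<^sup>T * G) \<in> carrier_mat r r" using P by simp
  have "?E * (P\<^sup>T * G) * P = ?E * mat_diag r v" using P V by (simp add: assoc)
  also have "\<dots> = mat_diag r (\<lambda>i. 1)"
    unfolding mat_diag_diag using v by (intro eq_matI) (auto simp: less_imp_neq[symmetric])
  finally show "?E * (P\<^sup>T * G) * P = 1\<^sub>m r" by simp
qed

lemma eigenvector_diag_col:
  assumes P: "P \<in> carrier_mat r r" and MP: "A * G * P = P * mat_diag r l" and j: "j < r"
  shows "A * G *\<^sub>v col P j = l j \<cdot>\<^sub>v col P j"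
proof -
  have "A * G *\<^sub>v col P j = col (A * G * P) j" using col_mult2[OF product_carrier P j] by simp
  also have "\<dots> = l j \<cdot>\<^sub>v col P j"
    unfolding MP mat_diag_mult_right[OF P] using P j by (intro eq_vecI) auto
  finally show ?thesis .
qed

lemma descending_eigenvalues_unique:
  assumes card: "card (spectrum (A * G)) = r"
    and P: "P \<in> carrier_mat r r" and Q: "Q \<in> carrier_mat r r" "Q * P = 1\<^sub>m r"
    and MP: "A * G * P = P * D" and D: "D \<in> desc_pos_diag r"
  shows "D = mat_diag r (\<lambda>i. rev (sorted_list_of_set (spectrum (A * G))) ! i)"
proof -
  define d where "d = (\<lambda>i. D $$ (i,i))"
  have Dd: "D = mat_diag r d"
    unfolding d_def using D by (intro diagonal_mat_eq_mat_diag) (auto simp: desc_pos_diag_def)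
  have "sorted_wrt (\<ge>) (map d [0..<r])"
    using D by (auto simp: desc_pos_diag_def d_def sorted_wrt_iff_nth_less)
  then have "map d [0..<r] = rev (sorted_list_of_set (spectrum (A * G)))"
    using char_poly_diagonalized[OF product_carrier P Q MP[unfolded Dd]]
    by (intro descending_roots_unique(2)[OF product_carrier card]) auto
  then have "d i = rev (sorted_list_of_set (spectrum (A * G))) ! i" if "i < r" for i
    using that by (metis add.left_neutral diff_zero length_upt nth_map nth_upt)
  then show ?thesis unfolding Dd by (intro eq_matI) auto
qed

lemma ordered_eigendecomp_exists:
  assumes card: "card (spectrum (A * G)) = r"
  shows "\<exists>L P. ordered_eigendecomp r (A * G) L P"
proof -
  define es where "es = rev (sorted_list_of_set (spectrum (A * G)))"
  define l where "l = (\<lambda>i. es ! i)"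
  have fin: "finite (spectrum (A * G))" by (rule card_finite_spectrum(1)[OF product_carrier])
  have len: "length es = r" and dist: "distinct es" and set: "set es = spectrum (A * G)"
    using card fin by (auto simp: es_def)
  have es: "map l [0..<r] = es" using map_nth[of es] by (simp only: l_def len)
  have inj: "inj_on l {..<r}"
    unfolding l_def by (rule inj_on_nth[OF dist]) (simp add: len)
  have "\<exists>u. u \<in> carrier_vec r \<and> u \<bullet> u = 1 \<and> A * G *\<^sub>v u = l j \<cdot>\<^sub>v u" if j: "j < r" for j
  proof -
    have "l j \<in> spectrum (A * G)" unfolding l_def set[symmetric] by (rule nth_mem) (simp add: j len)
    then obtain w where w: "w \<in> carrier_vec r" "w \<noteq> 0\<^sub>v r" "A * G *\<^sub>v w = l j \<cdot>\<^sub>v w"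
      by (auto simp: spectrum_def eigenvalue_def eigenvector_def)
    have pos: "0 < w \<bullet> w" using scalar_prod_self_real[OF w(1)] w(2) by linarith
    define k where "k = 1 / sqrt (w \<bullet> w)"
    have "(k \<cdot>\<^sub>v w) \<bullet> (k \<cdot>\<^sub>v w) = k\<^sup>2 * (w \<bullet> w)"
      using w by (simp add: power2_eq_square)
    also have "\<dots> = 1" using pos by (simp add: k_def power_divide)
    finally have "(k \<cdot>\<^sub>v w) \<bullet> (k \<cdot>\<^sub>v w) = 1" .
    moreover have "A * G *\<^sub>v (k \<cdot>\<^sub>v w) = l j \<cdot>\<^sub>v (k \<cdot>\<^sub>v w)"
      using mult_mat_vec[OF product_carrier w(1), of k] w(3)
      by (simp add: smult_smult_assoc mult.commute)
    ultimately show ?thesis using w by (intro exI[of _ "k \<cdot>\<^sub>v w"]) simp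
  qed
  then obtain u where u: "\<And>j. j < r \<Longrightarrow> u j \<in> carrier_vec r" "\<And>j. j < r \<Longrightarrow> u j \<bullet> u j = 1"
      "\<And>j. j < r \<Longrightarrow> A * G *\<^sub>v u j = l j \<cdot>\<^sub>v u j"
    by metis
  define P where "P = mat r r (\<lambda>(i,j). u j $ i)"
  have P: "P \<in> carrier_mat r r" by (simp add: P_def)
  have col: "col P j = u j" if "j < r" for j
    using u(1)[OF that] that by (intro eq_vecI) (auto simp: P_def)
  have nz: "col P j \<noteq> 0\<^sub>v r" if "j < r" for j
    using u(2)[OF that] by (auto simp: col[OF that])
  have MP: "A * G * P = P * mat_diag r l"
    unfolding mat_diag_mult_right[OF P]
  proof (intro eq_matI, goal_cases)
    case (1 i j)
    then have ij: "i < r" "j < r" by auto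
    have "(A * G * P) $$ (i,j) = (A * G *\<^sub>v u j) $ i"
      using ij P col[OF ij(2)] by (simp del: assoc_mult_mat_vec)
    also have "\<dots> = l j * u j $ i" using u(1,3)[OF ij(2)] ij by simp
    finally show ?case using ij by (simp add: P_def)
  qed (use P in auto)
  obtain v where v: "\<And>i. i < r \<Longrightarrow> 0 < v i" "P\<^sup>T * G * P = mat_diag r v"
    using gram_eigenvectors[OF P MP inj nz] by blast
  obtain Q where Q: "Q \<in> carrier_mat r r" "Q * P = 1\<^sub>m r" using gram_inverse[OF P _ v(2)] v(1) by blast
  have "sorted_wrt (\<ge>) es" by (simp add: es_def sorted_wrt_rev)
  then have "ordered_eigendecomp r (A * G) (mat_diag r l) P"
    using P MP u(2) col char_poly_diagonalized[OF product_carrier P Q MP]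
    by (simp add: ordered_eigendecomp_def es del: map_map)
  then show ?thesis by blast
qed

lemma ordered_eigendecompE:
  assumes card: "card (spectrum (A * G)) = r" and dec: "ordered_eigendecomp r (A * G) L P"
  obtains l v where "L = mat_diag r l" "inj_on l {..<r}" "L \<in> desc_pos_diag r"
    "P \<in> carrier_mat r r" "A * G * P = P * L"
    "\<And>i. i < r \<Longrightarrow> 0 < v i" "P\<^sup>T * G * P = mat_diag r v"
proof -
  define l where "l = (\<lambda>i. L $$ (i,i))"
  have L: "L \<in> carrier_mat r r" "diagonal_mat L" and P: "P \<in> carrier_mat r r"
    and MP: "A * G * P = P * L"
    and cp: "char_poly (A * G) = (\<Prod>a \<leftarrow> diag_mat L. [:- a, 1:])"
    and sorted: "sorted_wrt (\<ge>) (diag_mat L)"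
    and unit: "\<And>j. j < r \<Longrightarrow> sqrt (col P j \<bullet> col P j) = 1"
    using dec by (auto simp: ordered_eigendecomp_def)
  have Ll: "L = mat_diag r l" unfolding l_def by (rule diagonal_mat_eq_mat_diag[OF L])
  have dl: "diag_mat L = map l [0..<r]" by (simp add: Ll)
  have "distinct (map l [0..<r])"
    using descending_roots_unique(1)[OF product_carrier card cp _ sorted] by (simp add: dl)
  then have inj: "inj_on l {..<r}" by (simp add: distinct_map lessThan_atLeast0)
  have nz: "col P j \<noteq> 0\<^sub>v r" if "j < r" for j using unit[OF that] by auto
  note MPl = MP[unfolded Ll]
  have pos: "0 < l j" if j: "j < r" for j
    using eigenvalue_pos[OF _ nz[OF j] eigenvector_diag_col[OF P MPl j]] P j by auto
  have "l j \<le> l i" if "i \<le> j" "j < r" for i j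
  proof (cases "i = j")
    case False
    then show ?thesis using sorted that by (auto simp: dl sorted_wrt_iff_nth_less)
  qed simp
  then have D: "L \<in> desc_pos_diag r" using pos L by (auto simp: desc_pos_diag_def l_def)
  obtain v where "\<And>i. i < r \<Longrightarrow> 0 < v i" "P\<^sup>T * G * P = mat_diag r v"
    using gram_eigenvectors[OF P MPl inj nz] by blast
  then show ?thesis using that Ll inj D P MP by blast
qed

lemma normalized_eigenvectors:
  assumes card: "card (spectrum (A * G)) = r" and dec: "ordered_eigendecomp r (A * G) L P"
  defines "H \<equiv> P * inv_sqrt_mat (P\<^sup>T * G * P)"
  shows "H \<in> carrier_mat r r" "H\<^sup>T * G * H = 1\<^sub>m r" "A * G * H = H * L" "L \<in> desc_pos_diag r"
proof -
  obtain l v where L: "L = mat_diag r l" "L \<in> desc_pos_diag r"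
    and P: "P \<in> carrier_mat r r" and MP: "A * G * P = P * L"
    and v: "\<And>i. i < r \<Longrightarrow> 0 < v i" and V: "P\<^sup>T * G * P = mat_diag r v"
    using ordered_eigendecompE[OF card dec] by metis
  show "L \<in> desc_pos_diag r" by (rule L(2))
  have Pt: "P\<^sup>T \<in> carrier_mat r r" using P by simp
  define E where "E = mat_diag r (\<lambda>i. 1 / sqrt (v i))"
  have E: "E \<in> carrier_mat r r" and Et: "E\<^sup>T = E" by (auto simp: E_def mat_diag_def)
  have "mat_diag r (\<lambda>i. sqrt (v i)) * E = 1\<^sub>m r"
    unfolding E_def mat_diag_diag using v by (intro eq_matI) (auto simp: less_imp_neq[symmetric])
  moreover have "sqrt_mat (mat_diag r v) = mat_diag r (\<lambda>i. sqrt (v i))"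
    by (rule sqrt_mat_mat_diag) (rule v)
  ultimately have "inv_sqrt_mat (mat_diag r v) = E"
    unfolding inv_sqrt_mat_def using E by (simp add: inv_mat_eqI[of _ r])
  then have H: "H = P * E" by (simp add: H_def V)
  show Hc: "H \<in> carrier_mat r r" using P E by (simp add: H)
  have "H\<^sup>T * G * H = E * (P\<^sup>T * G * P) * E"
    using P Pt E by (simp add: H transpose_prod Et assoc)
  also have "\<dots> = 1\<^sub>m r"
    unfolding V E_def mat_diag_diag using v
    by (intro eq_matI) (auto simp: less_imp_neq[symmetric] less_imp_le field_simps)
  finally show "H\<^sup>T * G * H = 1\<^sub>m r" .
  have comm: "L * E = E * L" by (simp add: L(1) E_def mult.commute)
  have Lc: "L \<in> carrier_mat r r" by (simp add: L(1))
  have "A * G * H = A * G * P * E" using P E by (simp add: H assoc)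
  also have "\<dots> = H * L" using P E Lc comm by (simp add: MP H assoc)
  finally show "A * G * H = H * L" .
qed

lemma normalized_eigenvectors_unique:
  assumes H: "H \<in> carrier_mat r r" "H\<^sup>T * G * H = 1\<^sub>m r" "A * G * H = H * mat_diag r l"
    and K: "K \<in> carrier_mat r r" "K\<^sup>T * G * K = 1\<^sub>m r" "A * G * K = K * mat_diag r l"
    and inj: "inj_on l {..<r}"
  shows "\<exists>S \<in> sign_diag r. K = H * S"
proof -
  let ?D = "mat_diag r l"
  define Q where "Q = H\<^sup>T * G"
  have Ht: "H\<^sup>T \<in> carrier_mat r r" and Q: "Q \<in> carrier_mat r r" using H(1) by (auto simp: Q_def)
  have QH: "Q * H = 1\<^sub>m r" using H(2) by (simp add: Q_def)
  have HQ: "H * Q = 1\<^sub>m r" by (rule mat_mult_left_right_inverse[OF Q H(1) QH])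
  define S where "S = Q * K"
  have S: "S \<in> carrier_mat r r" using Q K(1) by (simp add: S_def)
  have "H * S = H * Q * K" using H(1) Q K(1) by (simp add: S_def assoc)
  then have KHS: "K = H * S" using K(1) by (simp add: HQ)
  have "?D * S = Q * H * (?D * S)" using S by (simp add: QH)
  also have "\<dots> = Q * (H * ?D) * S" using S H(1) Q by (simp add: assoc)
  also have "\<dots> = Q * (A * G * (H * S))"
    unfolding H(3)[symmetric] using S H(1) Q by (simp add: assoc)
  also have "\<dots> = S * ?D"
    unfolding KHS[symmetric] K(3) using K(1) Q by (simp add: S_def assoc)
  finally have comm: "?D * S = S * ?D" .
  define s where "s = (\<lambda>i. S $$ (i,i))"
  have diag: "diagonal_mat S" by (rule commute_mat_diag_inj[OF S comm inj])
  then have Ss: "S = mat_diag r s" unfolding s_def by (rule diagonal_mat_eq_mat_diag[OF S])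
  have St: "S\<^sup>T = S" unfolding Ss by (auto simp: mat_diag_def)
  have "K\<^sup>T * G * K = S * (H\<^sup>T * G * H) * S"
    using H(1) Ht S by (simp add: KHS transpose_prod St assoc)
  then have SS: "1\<^sub>m r = S * S" using S by (simp add: H(2) K(2))
  have "S $$ (i,i) = 1 \<or> S $$ (i,i) = -1" if "i < r" for i
  proof -
    have "s i * s i = 1"
      using arg_cong[OF SS, of "\<lambda>X. X $$ (i,i)"] that by (simp add: Ss)
    then have "s i = 1 \<or> s i = -1" by (simp add: square_eq_1_iff)
    then show ?thesis by (simp add: s_def)
  qed
  then show ?thesis using S diag KHS by (auto simp: sign_diag_def)
qed

end

lemma scaled_gram_rot_factors:
  assumes F: "Fs \<in> carrier_mat T r" and H: "H \<in> carrier_mat r r"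
  shows "scaled_gram T (rot_factors Fs H) = H\<^sup>T * scaled_gram T Fs * H"
proof -
  have Ft: "Fs\<^sup>T \<in> carrier_mat r T" and Ht: "H\<^sup>T \<in> carrier_mat r r"
    and FF: "Fs\<^sup>T * Fs \<in> carrier_mat r r" and FH: "Fs * H \<in> carrier_mat T r"
    using F H by auto
  have "(Fs * H)\<^sup>T * (Fs * H) = H\<^sup>T * (Fs\<^sup>T * Fs) * H"
    using assoc_mult_mat[OF Ht Ft FH] assoc_mult_mat[OF Ft F H] assoc_mult_mat[OF Ht FF H]
    by (simp add: transpose_mult[OF F H])
  then show ?thesis
    using mult_smult_distrib[OF Ht FF] mult_smult_assoc_mat[OF mult_carrier_mat[OF Ht FF] H]
    by (simp add: scaled_gram_def rot_factors_def)
qed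

lemma rotation_inverse:
  fixes G H :: "real mat"
  assumes "G \<in> carrier_mat r r" and "H \<in> carrier_mat r r" and "H\<^sup>T * G * H = 1\<^sub>m r"
  shows "inv_mat (H\<^sup>T) = G * H" and "H * (H\<^sup>T * G) = 1\<^sub>m r"
proof -
  have Ht: "H\<^sup>T \<in> carrier_mat r r" using assms by simp
  show "inv_mat (H\<^sup>T) = G * H"
    using assms assoc_mult_mat[OF Ht assms(1,2)] by (intro inv_mat_eqI[OF Ht]) auto
  show "H * (H\<^sup>T * G) = 1\<^sub>m r"
    using assms Ht by (intro mat_mult_left_right_inverse[OF mult_carrier_mat[OF Ht assms(1)]])
qed

lemma gram_rot_loadings:
  assumes B: "Bs \<in> carrier_mat N r" and G: "G \<in> carrier_mat r r" "G\<^sup>T = G"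
    and H: "H \<in> carrier_mat r r" "H\<^sup>T * G * H = 1\<^sub>m r"
  shows "(rot_loadings Bs H)\<^sup>T * rot_loadings Bs H = H\<^sup>T * G * (Bs\<^sup>T * Bs * G * H)"
proof -
  have Bt: "Bs\<^sup>T \<in> carrier_mat r N" and Ht: "H\<^sup>T \<in> carrier_mat r r"
    and GH: "G * H \<in> carrier_mat r r" and HG: "H\<^sup>T * G \<in> carrier_mat r r"
    and BGH: "Bs * (G * H) \<in> carrier_mat N r" and BB: "Bs\<^sup>T * Bs \<in> carrier_mat r r"
    using B G H by auto
  have "(Bs * (G * H))\<^sup>T * (Bs * (G * H)) = H\<^sup>T * G * Bs\<^sup>T * (Bs * (G * H))"
    by (simp add: transpose_mult[OF B GH] transpose_mult[OF G(1) H(1)] G(2))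
  also have "\<dots> = H\<^sup>T * G * (Bs\<^sup>T * Bs * G * H)"
    using assoc_mult_mat[OF HG Bt BGH] assoc_mult_mat[OF Bt B GH] assoc_mult_mat[OF BB G(1) H(1)]
    by simp
  finally show ?thesis by (simp add: rot_loadings_def rotation_inverse(1)[OF G(1) H])
qed

lemma normalizing_rotation_iff:
  assumes F: "Fs \<in> carrier_mat T r" and B: "Bs \<in> carrier_mat N r"
    and G: "G = scaled_gram T Fs" "G \<in> carrier_mat r r" "G\<^sup>T = G"
  shows "normalizing_rotation T r Fs Bs H \<longleftrightarrow>
    H \<in> carrier_mat r r \<and> H\<^sup>T * G * H = 1\<^sub>m r \<and>
    (\<exists>D \<in> desc_pos_diag r. Bs\<^sup>T * Bs * G * H = H * D)" (is "?N \<longleftrightarrow> ?R")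
proof
  assume ?N
  then have H: "H \<in> carrier_mat r r" "H\<^sup>T * G * H = 1\<^sub>m r"
    and D: "(rot_loadings Bs H)\<^sup>T * rot_loadings Bs H \<in> desc_pos_diag r"
    using scaled_gram_rot_factors[OF F] by (auto simp: normalizing_rotation_def G(1))
  have HG: "H\<^sup>T * G \<in> carrier_mat r r" and M: "Bs\<^sup>T * Bs * G * H \<in> carrier_mat r r"
    using H(1) G(2) B by auto
  have "H * (H\<^sup>T * G * (Bs\<^sup>T * Bs * G * H)) = Bs\<^sup>T * Bs * G * H"
    using assoc_mult_mat[OF H(1) HG M] left_mult_one_mat[OF M] rotation_inverse(2)[OF G(2) H] by simp
  then show ?R using H D gram_rot_loadings[OF B G(2,3) H] by metis
next
  assume ?R
  then obtain D where H: "H \<in> carrier_mat r r" "H\<^sup>T * G * H = 1\<^sub>m r"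
    and D: "D \<in> desc_pos_diag r" and MH: "Bs\<^sup>T * Bs * G * H = H * D" by auto
  have HG: "H\<^sup>T * G \<in> carrier_mat r r" and Dc: "D \<in> carrier_mat r r"
    using H(1) G(2) D by (auto simp: desc_pos_diag_def)
  have "(rot_loadings Bs H)\<^sup>T * rot_loadings Bs H = D"
    using gram_rot_loadings[OF B G(2,3) H] assoc_mult_mat[OF HG H(1) Dc] H(2) Dc by (simp add: MH)
  moreover have "invertible_mat H"
    using H HG rotation_inverse(2)[OF G(2) H] by (intro invertible_matI) auto
  ultimately show ?N
    using H D scaled_gram_rot_factors[OF F H(1)] by (simp add: normalizing_rotation_def G(1))
qed

theorem theorem1:
  fixes N T r :: nat and Fs Bs :: "real mat" and c :: real
  assumes "0 < N" and "0 < T" and "0 < r"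
    and "Fs \<in> carrier_mat T r" and "Bs \<in> carrier_mat N r"
    and "0 < c"
    and "c \<le> Min (spectrum (Bs\<^sup>T * Bs))"
    and "c \<le> Min (spectrum (scaled_gram T Fs))"
    and "card (spectrum (map_mat complex_of_real (Bs\<^sup>T * Bs * scaled_gram T Fs))) = r"
  shows
    "(\<exists>H. normalizing_rotation T r Fs Bs H) \<and>
     (\<forall>H. normalizing_rotation T r Fs Bs H \<longrightarrow>
        rot_factors Fs H * (rot_loadings Bs H)\<^sup>T = Fs * Bs\<^sup>T) \<and>
     (\<forall>H H'. normalizing_rotation T r Fs Bs H \<and> normalizing_rotation T r Fs Bs H' \<longrightarrow>
        (\<exists>S \<in> sign_diag r. H' = H * S)) \<and>
     (\<exists>L P. ordered_eigendecomp r (Bs\<^sup>T * Bs * scaled_gram T Fs) L P) \<and>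
     (\<forall>L P. ordered_eigendecomp r (Bs\<^sup>T * Bs * scaled_gram T Fs) L P \<longrightarrow>
        normalizing_rotation T r Fs Bs (P * inv_sqrt_mat (P\<^sup>T * scaled_gram T Fs * P)) \<and>
        (\<forall>H. normalizing_rotation T r Fs Bs H \<longrightarrow>
           (rot_loadings Bs H)\<^sup>T * rot_loadings Bs H = L))"
proof -
  define A where "A = Bs\<^sup>T * Bs"
  define G where "G = scaled_gram T Fs"
  have F: "Fs \<in> carrier_mat T r" and B: "Bs \<in> carrier_mat N r" by fact+
  have pdG: "pos_def_mat r G"
    unfolding G_def scaled_gram_def
    by (rule pos_def_mat_gram[OF F _ assms(6) assms(8)[unfolded scaled_gram_def]])
       (use assms(2) in simp)
  have one: "1 \<cdot>\<^sub>m (Bs\<^sup>T * Bs) = A" by (auto simp: A_def)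
  have pdA: "pos_def_mat r A"
    using pos_def_mat_gram[OF B, of 1 c] assms(6,7) unfolding one by (simp add: A_def)
  interpret pos_def_pair r A G by unfold_locales (rule pdA pdG)+
  have card: "card (spectrum (A * G)) = r"
    using assms(9) card_real_spectrum by (simp add: A_def G_def)
  note iff = normalizing_rotation_iff[OF F B G_def carriers(2) transposes(2), folded A_def]
  obtain L\<^sub>0 P\<^sub>0 where dec0: "ordered_eigendecomp r (A * G) L\<^sub>0 P\<^sub>0"
    using ordered_eigendecomp_exists[OF card] by blast
  obtain l\<^sub>0 where l0: "L\<^sub>0 = mat_diag r l\<^sub>0" "inj_on l\<^sub>0 {..<r}"
    using ordered_eigendecompE[OF card dec0] by metis
  have formula: "normalizing_rotation T r Fs Bs (P * inv_sqrt_mat (P\<^sup>T * G * P))"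
    if "ordered_eigendecomp r (A * G) L P" for L P
    unfolding iff using normalized_eigenvectors[OF card that] by blast
  have eigs: "A * G * H = H * L"
    if N: "normalizing_rotation T r Fs Bs H" and dec: "ordered_eigendecomp r (A * G) L P" for H L P
  proof -
    obtain D where H: "H \<in> carrier_mat r r" "H\<^sup>T * G * H = 1\<^sub>m r"
      and D: "D \<in> desc_pos_diag r" and MH: "A * G * H = H * D"
      using N unfolding iff by blast
    note K = normalized_eigenvectors[OF card dec]
    have HG: "X\<^sup>T * G \<in> carrier_mat r r" if "X \<in> carrier_mat r r" for X using that by simp
    have "D = L"
      using descending_eigenvalues_unique[OF card H(1) HG[OF H(1)] H(2) MH D]
        descending_eigenvalues_unique[OF card K(1) HG[OF K(1)] K(2) K(3) K(4)] by simp
    then show ?thesis using MH by simp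
  qed
  have loadings: "(rot_loadings Bs H)\<^sup>T * rot_loadings Bs H = L"
    if N: "normalizing_rotation T r Fs Bs H" and dec: "ordered_eigendecomp r (A * G) L P" for H L P
  proof -
    have H: "H \<in> carrier_mat r r" "H\<^sup>T * G * H = 1\<^sub>m r" using N unfolding iff by blast+
    have L: "L \<in> carrier_mat r r" using dec by (simp add: ordered_eigendecomp_def)
    have HG: "H\<^sup>T * G \<in> carrier_mat r r" using H(1) by simp
    show ?thesis
      using gram_rot_loadings[OF B carriers(2) transposes(2) H] eigs[OF N dec]
        assoc_mult_mat[OF HG H(1) L] H(2) L
      by (simp add: A_def)
  qed
  have unique: "\<exists>S \<in> sign_diag r. K = H * S"
    if N: "normalizing_rotation T r Fs Bs H" "normalizing_rotation T r Fs Bs K" for H K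
    using N eigs[OF N(1) dec0] eigs[OF N(2) dec0] unfolding iff l0(1)
    by (intro normalized_eigenvectors_unique[OF _ _ _ _ _ _ l0(2)]) auto
  have product: "rot_factors Fs H * (rot_loadings Bs H)\<^sup>T = Fs * Bs\<^sup>T"
    if N: "normalizing_rotation T r Fs Bs H" for H
  proof -
    have H: "H \<in> carrier_mat r r" "H\<^sup>T * G * H = 1\<^sub>m r" using N unfolding iff by blast+
    have HG: "H\<^sup>T * G \<in> carrier_mat r r" and GH: "G * H \<in> carrier_mat r r"
      and Bt: "Bs\<^sup>T \<in> carrier_mat r N" and HGB: "H\<^sup>T * G * Bs\<^sup>T \<in> carrier_mat r N"
      using H(1) B by auto
    have "(rot_loadings Bs H)\<^sup>T = H\<^sup>T * G * Bs\<^sup>T"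
      by (simp add: rot_loadings_def rotation_inverse(1)[OF carriers(2) H]
          transpose_mult[OF B GH] transpose_prod H(1))
    then show ?thesis
      using assoc_mult_mat[OF F H(1) HGB] assoc_mult_mat[OF H(1) HG Bt] Bt
        rotation_inverse(2)[OF carriers(2) H]
      by (simp add: rot_factors_def)
  qed
  show ?thesis
    using formula loadings unique product dec0 unfolding A_def G_def by blast
qed

end
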